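(* Let $G$ be a connected harmonic-uniform graph with $\operatorname{diam}(G)\leq 4$. Then $G$ contains at most one cut-vertex.
   Context: Graphs are finite, without loops or multiple edges. For a connected graph $G$, $d(u,v)$ denotes the distance (length of a shortest $u$-$v$-path). The harmonic centrality of a vertex $x$ of $G$ is $H_G(x)=\sum_{u\in V(G),\,u\neq x}\frac{1}{d(u,x)}$. The harmonic center $\mathcal{C}_H(G)$ is the subgraph of $G$ induced by the vertices with maximum harmonic centrality. $G$ is harmonic-uniform if $\mathcal{C}_H(G)\cong G$, i.e. all vertices of $G$ have the same harmonic centrality. *)

theory Defs
  imports "Graph_Theory.Graph_Theory"
begin

(* The locale graph models finite simple graphs as finite symmetric digraphs without loops
   and parallel arcs: an edge uv is a pair of opposite arcs. *)

context graph
begin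

(* \<mu> is the infimum of the walk costs; with unit costs it is the length of a shortest walk,
   and infinity between different components. *)
definition distance :: "'a \<Rightarrow> 'a \<Rightarrow> ereal" where
  "distance u v = \<mu> (\<lambda>_. 1) u v"

definition diameter :: ereal where
  "diameter = (SUP u\<in>verts G. SUP v\<in>verts G. distance u v)"

definition harmonic_centrality :: "'a \<Rightarrow> real" where
  "harmonic_centrality x = (\<Sum>u\<in>verts G - {x}. 1 / real_of_ereal (distance u x))"

definition harmonic_center :: "('a, 'b) pre_digraph" where
  "harmonic_center =
     G \<restriction> {x \<in> verts G. \<forall>y\<in>verts G. harmonic_centrality y \<le> harmonic_centrality x}"

definition harmonic_uniform :: bool where
  "harmonic_uniform \<longleftrightarrow> digraph_iso harmonic_center G"

(* A cut-vertex separates two other vertices of the same component. *)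
definition cut_vertex :: "'a \<Rightarrow> bool" where
  "cut_vertex v \<longleftrightarrow> v \<in> verts G \<and>
     (\<exists>u\<in>verts G - {v}. \<exists>w\<in>verts G - {v}. u \<rightarrow>\<^sup>*\<^bsub>G\<^esub> w \<and> \<not> u \<rightarrow>\<^sup>*\<^bsub>del_vert v\<^esub> w)"

end

end

theory Submission
  imports Defs
begin

text \<open>
  For a vertex \<open>v\<close> and another vertex \<open>w\<close>, let the far side of \<open>v\<close> from \<open>w\<close> be the union of those
  components of \<open>G - v\<close> that do not contain \<open>w\<close>. Every walk that leaves it passes through \<open>v\<close>, so
  distances add up at \<open>v\<close> (\<open>hops_far_side\<close>); if \<open>v\<close> is a cut-vertex, it is nonempty.

  Suppose that \<open>v\<close> and \<open>w\<close> are distinct cut-vertices, and let \<open>A\<close> be the far side of \<open>v\<close> from \<open>w\<close>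
  and \<open>B\<close> that of \<open>w\<close> from \<open>v\<close>. A path from \<open>a \<in> A\<close> to \<open>b \<in> B\<close> has to pass \<open>v\<close> and then \<open>w\<close>, so
  \<open>d(a,v) + d(v,w) + d(w,b) = d(a,b) \<le> 4\<close>. Hence \<open>d(a,v)\<close> and \<open>d(w,b)\<close> are not both at least \<open>2\<close>, and
  on one of the two sides, say \<open>A\<close>, all vertices are neighbours of the cut-vertex \<open>v\<close>. But then \<open>v\<close>
  is strictly more central than every \<open>a \<in> A\<close> (\<open>harmonic_centrality_far_side_less\<close>): the vertices of
  \<open>A\<close> are as close to \<open>v\<close> as possible, and all vertices outside \<open>A\<close> are closer to \<open>v\<close> than to \<open>a\<close>.
  This contradicts uniformity.
\<close>

lemma (in wf_digraph) reachable_del_vert_if_awalk_avoids: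
  assumes "awalk u p w" "v \<notin> set (awalk_verts u p)"
  shows "u \<rightarrow>\<^sup>*\<^bsub>del_vert v\<^esub> w"
  using assms
proof (induction p arbitrary: u)
  case Nil
  then show ?case
    by (auto simp: awalk_Nil_iff reachable_def verts_del_vert intro: rtrancl_on_refl)
next
  case (Cons e p)
  interpret D: wf_digraph "del_vert v" by (rule wf_digraph_del_vert)
  have e: "e \<in> arcs G" "u = tail G e" "awalk (head G e) p w"
    using Cons.prems(1) by (auto simp: awalk_Cons_iff)
  have avoid: "u \<noteq> v" "v \<notin> set (awalk_verts (head G e) p)"
    using Cons.prems(2) e by auto
  then have "head G e \<noteq> v"
    using hd_in_awalk_verts(1)[OF e(3)] by auto
  then have "u \<rightarrow>\<^bsub>del_vert v\<^esub> head G e"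
    using e avoid(1) by (auto simp: arcs_ends_conv del_vert_simps)
  then show ?case
    using Cons.IH[OF e(3) avoid(2)] by (rule D.adj_reachable_trans)
qed

lemma (in sym_digraph) awalk_reversible:
  assumes "awalk u p v"
  shows "\<exists>q. awalk v q u \<and> length q = length p"
  using assms
proof (induction p arbitrary: u)
  case Nil
  then show ?case by (auto simp: awalk_Nil_iff)
next
  case (Cons e p)
  have e: "e \<in> arcs G" "u = tail G e" "awalk (head G e) p v"
    using Cons.prems by (auto simp: awalk_Cons_iff)
  obtain q where q: "awalk v q (head G e)" "length q = length p"
    using Cons.IH e(3) by blast
  obtain e' where e': "e' \<in> arcs G" "tail G e' = head G e" "head G e' = u"
    using sym_arcs e(1,2) unfolding symmetric_conv by metis
  then have "awalk (head G e) [e'] u"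
    by (auto simp: awalk_simps)
  then have "awalk v (q @ [e']) u"
    using q(1) by (rule awalk_appendI[rotated])
  then show ?case using q(2) by (intro exI[of _ "q @ [e']"]) simp
qed

locale connected_graph = graph G for G :: "('a, 'b) pre_digraph" (structure) +
  assumes connected: "Digraph_Component.connected G"
begin

text \<open>
  The distance as a natural number; by \<open>distance_eq_hops\<close> it is the extended real \<open>distance\<close>, which is
  finite here because the graph is connected.
\<close>

definition hops :: "'a \<Rightarrow> 'a \<Rightarrow> nat" where
  "hops u v = (LEAST n. \<exists>p. awalk u p v \<and> length p = n)"

lemma hops_le: "awalk u p v \<Longrightarrow> hops u v \<le> length p"
  unfolding hops_def by (rule Least_le) auto

lemma shortest_awalk:
  assumes "u \<in> verts G" "v \<in> verts G"
  obtains p where "awalk u p v" "length p = hops u v"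
proof -
  have "u \<rightarrow>\<^sup>*\<^bsub>mk_symmetric G\<^esub> v"
    using connected assms unfolding connected_def strongly_connected_def by simp
  then have "u \<rightarrow>\<^sup>* v"
    using reachable_mk_symmetric_eq[OF sym_arcs] by blast
  then obtain p where "awalk u p v"
    by (auto simp: reachable_awalk)
  then have "\<exists>n p. awalk u p v \<and> length p = n" by blast
  then have "\<exists>p. awalk u p v \<and> length p = hops u v"
    unfolding hops_def by (rule LeastI_ex)
  then show ?thesis using that by blast
qed

lemma distance_eq_hops:
  assumes "u \<in> verts G" "v \<in> verts G"
  shows "distance u v = ereal (real (hops u v))"
proof -
  have cost: "awalk_cost (\<lambda>_. 1) p = real (length p)" for p :: "'b list"
    by (induction p) auto
  obtain p where p: "awalk u p v" "length p = hops u v"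
    using assms by (rule shortest_awalk)
  show ?thesis
    unfolding distance_def
  proof (rule antisym)
    show "\<mu> (\<lambda>_. 1) u v \<le> ereal (real (hops u v))"
      using min_cost_le_walk_cost[OF p(1), of "\<lambda>_. 1"] p(2) by (simp add: cost)
    show "ereal (real (hops u v)) \<le> \<mu> (\<lambda>_. 1) u v"
      unfolding \<mu>_def by (rule INF_greatest) (auto simp: cost intro: hops_le)
  qed
qed

lemma hops_le_diameter:
  assumes "u \<in> verts G" "v \<in> verts G"
  shows "ereal (real (hops u v)) \<le> diameter"
proof -
  have "distance u v \<le> diameter"
    unfolding diameter_def using assms by (meson SUP_upper2 order_refl)
  then show ?thesis using distance_eq_hops[OF assms] by simp
qed

lemma hops_eq_0_iff:
  assumes "u \<in> verts G" "v \<in> verts G"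
  shows "hops u v = 0 \<longleftrightarrow> u = v"
proof
  assume "hops u v = 0"
  with shortest_awalk[OF assms] show "u = v"
    by (metis awalk_empty_ends length_0_conv)
next
  assume "u = v"
  then show "hops u v = 0"
    using hops_le[of u "[]" v] assms by (simp add: awalk_Nil_iff)
qed

lemma hops_commute:
  assumes "u \<in> verts G" "v \<in> verts G"
  shows "hops u v = hops v u"
proof -
  have le: "hops x y \<le> hops y x" if xy: "x \<in> verts G" "y \<in> verts G" for x y
  proof -
    obtain p where "awalk y p x" "length p = hops y x"
      using xy(2,1) by (rule shortest_awalk)
    then show ?thesis
      using awalk_reversible hops_le by metis
  qed
  show ?thesis using le[OF assms] le[OF assms(2,1)] by (rule antisym)
qed

lemma hops_triangle:
  assumes "u \<in> verts G" "v \<in> verts G" "w \<in> verts G"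
  shows "hops u w \<le> hops u v + hops v w"
proof -
  obtain p where p: "awalk u p v" "length p = hops u v"
    using assms(1,2) by (rule shortest_awalk)
  obtain q where q: "awalk v q w" "length q = hops v w"
    using assms(2,3) by (rule shortest_awalk)
  have "hops u w \<le> length (p @ q)"
    using p(1) q(1) by (intro hops_le awalk_appendI)
  then show ?thesis using p(2) q(2) by simp
qed

definition far_side :: "'a \<Rightarrow> 'a \<Rightarrow> 'a set" where
  "far_side v w = {x \<in> verts G - {v}. \<not> x \<rightarrow>\<^sup>*\<^bsub>del_vert v\<^esub> w}"

lemma reachable_del_vert_commute: "x \<rightarrow>\<^sup>*\<^bsub>del_vert v\<^esub> y \<Longrightarrow> y \<rightarrow>\<^sup>*\<^bsub>del_vert v\<^esub> x"
proof (rule symmetric_reachable)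
  show "symmetric (del_vert v)"
    using sym_arcs unfolding symmetric_conv del_vert_simps by auto
qed

lemma far_sideD: "a \<in> far_side v w \<Longrightarrow> a \<in> verts G \<and> a \<noteq> v"
  unfolding far_side_def by auto

lemma base_not_in_far_side:
  assumes "w \<in> verts G" "w \<noteq> v"
  shows "w \<notin> far_side v w"
  using assms
  by (auto simp: far_side_def reachable_def verts_del_vert intro: rtrancl_on_refl)

text \<open>The two vertices that a cut-vertex separates cannot both be connected to \<open>w\<close> without it.\<close>

lemma far_side_nonempty:
  assumes "cut_vertex v"
  shows "far_side v w \<noteq> {}"
proof -
  interpret D: wf_digraph "del_vert v" by (rule wf_digraph_del_vert)
  obtain x y where xy: "x \<in> verts G - {v}" "y \<in> verts G - {v}" "\<not> x \<rightarrow>\<^sup>*\<^bsub>del_vert v\<^esub> y"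
    using assms unfolding cut_vertex_def by blast
  then have "\<not> x \<rightarrow>\<^sup>*\<^bsub>del_vert v\<^esub> w \<or> \<not> y \<rightarrow>\<^sup>*\<^bsub>del_vert v\<^esub> w"
    using reachable_del_vert_commute D.reachable_trans by blast
  then show ?thesis using xy unfolding far_side_def by blast
qed

lemma hops_far_side:
  assumes a: "a \<in> far_side v w" and y: "y \<in> verts G" "y \<notin> far_side v w"
    and v: "v \<in> verts G"
  shows "hops a y = hops a v + hops v y"
proof (rule antisym)
  interpret D: wf_digraph "del_vert v" by (rule wf_digraph_del_vert)
  have av: "a \<in> verts G" using far_sideD[OF a] by blast
  show "hops a y \<le> hops a v + hops v y"
    using av v y(1) by (rule hops_triangle)
  obtain p where p: "awalk a p y" "length p = hops a y"
    using av y(1) by (rule shortest_awalk)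
  have "v \<in> set (awalk_verts a p)"
  proof (rule ccontr)
    assume avoid: "v \<notin> set (awalk_verts a p)"
    then have "y \<noteq> v"
      using p(1) by auto
    then have "y \<rightarrow>\<^sup>*\<^bsub>del_vert v\<^esub> w"
      using y unfolding far_side_def by blast
    with reachable_del_vert_if_awalk_avoids[OF p(1) avoid] have "a \<rightarrow>\<^sup>*\<^bsub>del_vert v\<^esub> w"
      by (rule D.reachable_trans)
    then show False using a unfolding far_side_def by blast
  qed
  then obtain q r where "p = q @ r" "awalk a q v" "awalk v r y"
    using awalk_decomp[OF p(1)] by blast
  then show "hops a v + hops v y \<le> hops a y"
    using hops_le[of a q v] hops_le[of v r y] p(2) by simp
qed

text \<open>
  A common element \<open>x\<close> would have \<open>v\<close> on all its walks to \<open>w\<close> and \<open>w\<close> on all its walks to \<open>v\<close>, so each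
  of \<open>v\<close> and \<open>w\<close> would be strictly closer to \<open>x\<close> than the other one.
\<close>

lemma far_sides_disjoint:
  assumes "v \<in> verts G" "w \<in> verts G" "v \<noteq> w"
  shows "far_side v w \<inter> far_side w v = {}"
proof (rule ccontr)
  assume "far_side v w \<inter> far_side w v \<noteq> {}"
  then obtain x where x: "x \<in> far_side v w" "x \<in> far_side w v" by blast
  have "hops x w = hops x v + hops v w" "hops x v = hops x w + hops w v"
    using hops_far_side[OF x(1) assms(2) _ assms(1)] hops_far_side[OF x(2) assms(1) _ assms(2)]
      base_not_in_far_side assms by auto
  then have "hops v w = 0" by simp
  then show False using hops_eq_0_iff assms by blast
qed

lemma harmonic_centrality_far_side_less:
  assumes v: "v \<in> verts G" and w: "w \<in> verts G" "w \<noteq> v"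
    and near: "\<And>x. x \<in> far_side v w \<Longrightarrow> hops x v = 1"
    and a: "a \<in> far_side v w"
  shows "harmonic_centrality a < harmonic_centrality v"
proof -
  have aV: "a \<in> verts G" "a \<noteq> v" using far_sideD[OF a] by auto
  have wS: "w \<notin> far_side v w" using w by (rule base_not_in_far_side)
  let ?R = "verts G - {a, v}"
  have pos: "0 < hops u x" if "u \<in> verts G" "x \<in> verts G" "u \<noteq> x" for u x
    using hops_eq_0_iff[OF that(1,2)] that(3) by simp
  \<comment> \<open>The contributions of \<open>a\<close> and \<open>v\<close> to each other are equal, so only the sums over \<open>?R\<close> matter.\<close>
  have split: "harmonic_centrality x = 1 / real (hops y x) + (\<Sum>u\<in>?R. 1 / real (hops u x))"
    if "{x, y} = {a, v}" "x \<noteq> y" for x y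
  proof -
    have xV: "x \<in> verts G" "y \<in> verts G" using that aV v by (auto simp: doubleton_eq_iff)
    have "harmonic_centrality x = (\<Sum>u\<in>verts G - {x}. 1 / real (hops u x))"
      unfolding harmonic_centrality_def using xV
      by (intro sum.cong) (auto simp: distance_eq_hops)
    also have "verts G - {x} = insert y ?R" using that xV by (auto simp: doubleton_eq_iff)
    also have "(\<Sum>u\<in>\<dots>. 1 / real (hops u x))
        = 1 / real (hops y x) + (\<Sum>u\<in>?R. 1 / real (hops u x))"
      using that by (subst sum.insert) (auto simp: doubleton_eq_iff)
    finally show ?thesis .
  qed
  have outside: "hops u v < hops u a" if u: "u \<in> verts G" "u \<notin> far_side v w" for u
  proof -
    have "hops a u = hops a v + hops v u"
      using hops_far_side[OF a u v] .
    then show ?thesis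
      using near[OF a] hops_commute[OF u(1) v] hops_commute[OF u(1) aV(1)] by simp
  qed
  have "(\<Sum>u\<in>?R. 1 / real (hops u a)) < (\<Sum>u\<in>?R. 1 / real (hops u v))"
  proof (rule sum_strict_mono_ex1)
    show "finite ?R" by simp
    show "\<forall>u\<in>?R. 1 / real (hops u a) \<le> 1 / real (hops u v)"
    proof
      fix u assume u: "u \<in> ?R"
      then have "hops u v \<le> hops u a"
        using near[of u] outside[of u] pos[of u a] aV by (cases "u \<in> far_side v w") auto
      moreover have "0 < hops u v" using u v pos by auto
      ultimately show "1 / real (hops u a) \<le> 1 / real (hops u v)"
        by (simp add: frac_le)
    qed
    have "w \<in> ?R" using w a wS by auto
    moreover have "1 / real (hops w a) < 1 / real (hops w v)"
      using outside[OF w(1) wS] pos[OF w(1) v w(2)] by (simp add: frac_less2)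
    ultimately show "\<exists>u\<in>?R. 1 / real (hops u a) < 1 / real (hops u v)" by blast
  qed
  then show ?thesis
    using split[of a v] split[of v a] aV(2) hops_commute[OF aV(1) v]
    by (simp add: insert_commute)
qed

text \<open>
  An isomorphism preserves the number of vertices, and in a finite graph only the whole vertex set
  has as many vertices as \<open>G\<close>.
\<close>

lemma harmonic_uniform_centrality_eq:
  assumes "harmonic_uniform" "x \<in> verts G" "y \<in> verts G"
  shows "harmonic_centrality x = harmonic_centrality y"
proof -
  obtain f where "G = app_iso f harmonic_center"
    using assms(1) unfolding harmonic_uniform_def digraph_iso_def by blast
  then have "verts G = iso_verts f ` verts harmonic_center"
    by (metis verts_app_iso)
  moreover have sub: "verts harmonic_center \<subseteq> verts G"
    unfolding harmonic_center_def by auto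
  ultimately have "card (verts G) \<le> card (verts harmonic_center)"
    by (metis card_image_le finite_subset finite_verts)
  then have "verts harmonic_center = verts G"
    using sub by (intro card_seteq) auto
  then show ?thesis
    using assms(2,3) unfolding harmonic_center_def by (auto intro: antisym)
qed

lemma harmonic_uniform_diameter_le_4_cut_vertex_unique:
  assumes unif: "harmonic_uniform" and diam: "diameter \<le> 4"
    and cut: "cut_vertex v" "cut_vertex w"
  shows "v = w"
proof (rule ccontr)
  assume ne: "v \<noteq> w"
  have V: "v \<in> verts G" "w \<in> verts G" using cut unfolding cut_vertex_def by auto
  have far: "\<exists>a\<in>far_side x y. 2 \<le> hops a x"
    if xy: "x \<in> verts G" "y \<in> verts G" "x \<noteq> y" "cut_vertex x" for x y
  proof (rule ccontr)
    assume not_far: "\<not> ?thesis"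
    have near: "hops a x = 1" if a: "a \<in> far_side x y" for a
    proof -
      have "hops a x < 2" "hops a x \<noteq> 0"
        using not_far a far_sideD[OF a] hops_eq_0_iff[of a x] xy(1) by auto
      then show ?thesis by simp
    qed
    obtain a where a: "a \<in> far_side x y" using far_side_nonempty[OF xy(4)] by blast
    have "harmonic_centrality a < harmonic_centrality x"
      using xy(1,2) xy(3)[symmetric] near a by (rule harmonic_centrality_far_side_less)
    moreover have "harmonic_centrality a = harmonic_centrality x"
      using unif far_sideD[OF a] xy(1) by (intro harmonic_uniform_centrality_eq) auto
    ultimately show False by simp
  qed
  obtain a where a: "a \<in> far_side v w" "2 \<le> hops a v"
    using far[OF V ne cut(1)] by blast
  obtain b where b: "b \<in> far_side w v" "2 \<le> hops b w"
    using far[OF V(2,1) ne[symmetric] cut(2)] by blast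
  have ab: "a \<in> verts G" "b \<in> verts G" using far_sideD a(1) b(1) by blast+
  have "b \<notin> far_side v w" using far_sides_disjoint[OF V ne] b(1) by blast
  then have "hops a b = hops a v + hops v b"
    using hops_far_side[OF a(1) ab(2) _ V(1)] by blast
  moreover have "hops b v = hops b w + hops w v"
    using hops_far_side[OF b(1) V(1) base_not_in_far_side[OF V(1) ne] V(2)] .
  moreover have "hops w v \<noteq> 0" using hops_eq_0_iff V ne by metis
  ultimately have "5 \<le> hops a b"
    using a(2) b(2) hops_commute[OF ab(2) V(1)] by simp
  moreover have "ereal (real (hops a b)) \<le> 4"
    using hops_le_diameter[OF ab] diam by (rule order_trans)
  ultimately show False
    by simp
qed

end

theorem theorem5:
  fixes G :: "('a, 'b) pre_digraph"
  assumes "graph G"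
    and "Digraph_Component.connected G"
    and "graph.harmonic_uniform G"
    and "graph.diameter G \<le> 4"
  shows "card {v \<in> verts G. graph.cut_vertex G v} \<le> 1"
proof -
  interpret connected_graph G
    using assms(1,2) by (simp add: connected_graph_def connected_graph_axioms_def)
  have "\<forall>v\<in>{v \<in> verts G. cut_vertex v}. \<forall>w\<in>{v \<in> verts G. cut_vertex v}. v = w"
    using harmonic_uniform_diameter_le_4_cut_vertex_unique[OF assms(3,4)] by blast
  then show ?thesis
    by (simp add: card_le_Suc0_iff_eq)
qed

end
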